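(* Let $A\succ 0$ be a $d\times d$ real symmetric matrix, $T\ge 1$, $x_0\in\mathbb{R}^d$, and suppose the minimizers $\{v_t\}_{t=1}^T$ form a martingale, i.e. $\mathbb{E}[v_s\mid\mathcal{F}_t]=v_t$ for all $1\le t\le s\le T$. Let LAI be the algorithm $x_t=C_t x_{t-1}+(I-C_t)v_t$, $t=1,\dots,T$, where $C_T=(I+A)^{-1}$ and $C_t^{-1}=2I+A-C_{t+1}$ for $1\le t\le T-1$. Then LAI is online optimal (it minimizes the expected total cost $\mathbb{E}[\mathrm{Cost}[1,T]]$ among all online algorithms), and its expected total cost satisfies $$\mathbb{E}[\mathrm{Cost}_{\mathrm{LAI}}[1,T]]=\sum_{t=1}^{T}\frac12\,\mathbb{E}\left[(v_t-v_{t-1})^T(I-C_t)(v_t-v_{t-1})\right]\le\sum_{t=1}^{T}\frac12\,\mathbb{E}\left[(v_t-v_{t-1})^T(I-C_L)(v_t-v_{t-1})\right],$$ where $C_L=\frac{A+2I-\sqrt{A^2+4A}}{2}$ and $v_0=x_0$.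
   Context: Smoothed online quadratic optimization: starting from a given deterministic $x_0\in\mathbb{R}^d$, at each round $t=1,\dots,T$ the vector $v_t\in\mathbb{R}^d$ is revealed and the player picks $x_t\in\mathbb{R}^d$, paying the hitting cost $f_t(x_t)=\frac12(x_t-v_t)^TA(x_t-v_t)$ and the switching cost $\frac12\|x_t-x_{t-1}\|_2^2$. The total cost is $\mathrm{Cost}[1,T]=\sum_{t=1}^T\left(f_t(x_t)+\frac12\|x_t-x_{t-1}\|_2^2\right)$. In the stochastic setting $\{v_t\}_{t=1}^T$ is a stochastic process with natural filtration $\mathcal{F}_t=\sigma(v_1,\dots,v_t)$ ($\mathcal{F}_0$ trivial), and the increments $v_t-v_{t-1}$ have finite covariance. An online algorithm is a sequence $(x_t)_{t=1}^T$ with $x_t$ being $\mathcal{F}_t$-measurable. $\sqrt{M}$ denotes the unique positive definite square root of a positive definite matrix $M$. *)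

theory Defs
  imports "HOL-Probability.Probability"
begin

definition pos_def :: "real ^ 'n ^ 'n \<Rightarrow> bool" where
  "pos_def A \<longleftrightarrow> transpose A = A \<and> (\<forall>x. x \<noteq> 0 \<longrightarrow> x \<bullet> (A *v x) > 0)"

(* Meaningful for positive definite M, where exactly one such S exists. *)
definition mat_sqrt :: "real ^ 'n ^ 'n \<Rightarrow> real ^ 'n ^ 'n" where
  "mat_sqrt M = (THE S. pos_def S \<and> S ** S = M)"

definition hitting_cost :: "real ^ 'n ^ 'n \<Rightarrow> real ^ 'n \<Rightarrow> real ^ 'n \<Rightarrow> real" where
  "hitting_cost A v x = 1/2 * ((x - v) \<bullet> (A *v (x - v)))"

definition total_cost ::
  "real ^ 'n ^ 'n \<Rightarrow> nat \<Rightarrow> (nat \<Rightarrow> 'w \<Rightarrow> real ^ 'n) \<Rightarrow> (nat \<Rightarrow> 'w \<Rightarrow> real ^ 'n) \<Rightarrow> 'w \<Rightarrow> real" where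
  "total_cost A T v x \<omega> =
     (\<Sum>t=1..T. hitting_cost A (v t \<omega>) (x t \<omega>) + 1/2 * (norm (x t \<omega> - x (t - 1) \<omega>))\<^sup>2)"

(* For t = 0 the generating family is empty, so the sigma-algebra is trivial. *)
definition natural_filtration ::
  "'w measure \<Rightarrow> (nat \<Rightarrow> 'w \<Rightarrow> real ^ 'n) \<Rightarrow> nat \<Rightarrow> 'w measure" where
  "natural_filtration M v t =
     sigma (space M) (\<Union>i\<in>{1..t}. {v i -` B \<inter> space M | B. B \<in> sets borel})"

(* Conditional expectations of vectors are taken componentwise. The value v 0 plays no role. *)
definition martingale_upto ::
  "'w measure \<Rightarrow> nat \<Rightarrow> (nat \<Rightarrow> 'w \<Rightarrow> real ^ 'n) \<Rightarrow> bool" where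
  "martingale_upto M T v \<longleftrightarrow>
     (\<forall>t\<in>{1..T}. integrable M (v t)) \<and>
     (\<forall>t s. 1 \<le> t \<and> t \<le> s \<and> s \<le> T \<longrightarrow>
        (AE \<omega> in M. \<forall>i. real_cond_exp M (natural_filtration M v t) (\<lambda>\<omega>. v s \<omega> $ i) \<omega> = v t \<omega> $ i))"

(* Entrywise existence of the second moments of a random vector. For an integrable random
   vector on a probability space this is finiteness of the covariance matrix. *)
definition finite_covariance :: "'w measure \<Rightarrow> ('w \<Rightarrow> real ^ 'n) \<Rightarrow> bool" where
  "finite_covariance M X \<longleftrightarrow> (\<forall>i j. integrable M (\<lambda>\<omega>. X \<omega> $ i * X \<omega> $ j))"

(* The starting point is carried as the constant zeroth entry of the decision sequence. *)
definition online_algorithm ::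
  "'w measure \<Rightarrow> nat \<Rightarrow> real ^ 'n \<Rightarrow> (nat \<Rightarrow> 'w \<Rightarrow> real ^ 'n) \<Rightarrow> (nat \<Rightarrow> 'w \<Rightarrow> real ^ 'n) \<Rightarrow> bool" where
  "online_algorithm M T x0 v x \<longleftrightarrow>
     x 0 = (\<lambda>_. x0) \<and> (\<forall>t\<in>{1..T}. x t \<in> borel_measurable (natural_filtration M v t))"

(* Online algorithms need not be integrable, so the expectation of the (nonnegative) total cost
   is taken in the extended sense and may be infinite. *)
definition expected_cost ::
  "'w measure \<Rightarrow> real ^ 'n ^ 'n \<Rightarrow> nat \<Rightarrow> (nat \<Rightarrow> 'w \<Rightarrow> real ^ 'n) \<Rightarrow> (nat \<Rightarrow> 'w \<Rightarrow> real ^ 'n) \<Rightarrow> ennreal" where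
  "expected_cost M A T v x = (\<integral>\<^sup>+ \<omega>. ennreal (total_cost A T v x \<omega>) \<partial>M)"

definition online_optimal ::
  "'w measure \<Rightarrow> real ^ 'n ^ 'n \<Rightarrow> nat \<Rightarrow> real ^ 'n \<Rightarrow> (nat \<Rightarrow> 'w \<Rightarrow> real ^ 'n) \<Rightarrow> (nat \<Rightarrow> 'w \<Rightarrow> real ^ 'n) \<Rightarrow> bool" where
  "online_optimal M A T x0 v x \<longleftrightarrow>
     online_algorithm M T x0 v x \<and>
     (\<forall>y. online_algorithm M T x0 v y \<longrightarrow> expected_cost M A T v x \<le> expected_cost M A T v y)"

(* Number of rounds to go: lai_back A k is the matrix C_(T - k). *)
fun lai_back :: "real ^ 'n ^ 'n \<Rightarrow> nat \<Rightarrow> real ^ 'n ^ 'n" where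
  "lai_back A 0 = matrix_inv (mat 1 + A)"
| "lai_back A (Suc k) = matrix_inv (2 *\<^sub>R mat 1 + A - lai_back A k)"

(* C_T = (I + A)^-1 and C_t = (2 I + A - C_(t+1))^-1 for t < T. *)
definition lai_C :: "real ^ 'n ^ 'n \<Rightarrow> nat \<Rightarrow> nat \<Rightarrow> real ^ 'n ^ 'n" where
  "lai_C A T t = lai_back A (T - t)"

fun lai ::
  "real ^ 'n ^ 'n \<Rightarrow> nat \<Rightarrow> real ^ 'n \<Rightarrow> (nat \<Rightarrow> 'w \<Rightarrow> real ^ 'n) \<Rightarrow> nat \<Rightarrow> 'w \<Rightarrow> real ^ 'n" where
  "lai A T x0 v 0 \<omega> = x0"
| "lai A T x0 v (Suc t) \<omega> =
     lai_C A T (Suc t) *v lai A T x0 v t \<omega> + (mat 1 - lai_C A T (Suc t)) *v v (Suc t) \<omega>"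

definition C_L :: "real ^ 'n ^ 'n \<Rightarrow> real ^ 'n ^ 'n" where
  "C_L A = (1/2) *\<^sub>R (A + 2 *\<^sub>R mat 1 - mat_sqrt (A ** A + 4 *\<^sub>R A))"

end

(* Put w_t = x_t - v_t, d_t = v_t - v_(t-1), P_t = I - C_t and C_(T+1) = I. Completing the square
   in w_t against the value function 1/2 (x_(t-1) - v_t)^T P_t (x_(t-1) - v_t) and summing over t
   gives, along every path and for every decision sequence,
     Cost = sum_t (1/2 d_t^T P_t d_t - w_(t-1)^T P_t d_t + 1/2 e_t^T C_t^(-1) e_t),
   where e_t = x_t - C_t x_(t-1) - (I - C_t) v_t vanishes exactly for LAI. The middle terms have mean
   zero because d_t is a martingale increment; finite expected cost makes w_(t-1) square integrable.

   C_L is the limit of the backward recursion, which decreases in the Loewner order: the limit C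
   satisfies C (2 I + A - C) = I, so A + 2 I - 2 C is a positive definite square root of A^2 + 4 A.
   Uniqueness of the root follows from S X + X R = 0 ==> X = 0 applied to the difference X = S - R,
   so no spectral theorem is needed. *)
theory Submission
  imports Defs
begin

subsection \<open>The matrix recursion and its limit\<close>

lemma inner_sym_matrix:
  fixes A :: "real ^ 'n ^ 'n"
  assumes "transpose A = A"
  shows "(A *v x) \<bullet> y = x \<bullet> (A *v y)"
  by (metis assms dot_lmul_matrix transpose_matrix_vector)

lemma pos_def_nonneg:
  assumes "pos_def A"
  shows "0 \<le> x \<bullet> (A *v x)"
  using assms by (cases "x = 0") (auto simp: pos_def_def intro: less_imp_le)

text \<open>A positive definite matrix has trivial kernel, hence a two-sided inverse, which
  \<open>matrix_inv\<close> then picks. Transposing the left-inverse equation exhibits the transpose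
  as a further right inverse, and inverses are unique.\<close>

lemma pos_def_inverse:
  fixes D :: "real ^ 'n ^ 'n"
  assumes "pos_def D"
  shows pos_def_matrix_inv_left: "matrix_inv D ** D = mat 1"
    and pos_def_matrix_inv_right: "D ** matrix_inv D = mat 1"
    and transpose_matrix_inv_pos_def: "transpose (matrix_inv D) = matrix_inv D"
proof -
  have "\<forall>x. D *v x = 0 \<longrightarrow> x = 0"
    using assms unfolding pos_def_def by (metis inner_zero_right less_irrefl)
  then have "invertible D"
    by (metis matrix_left_invertible_ker invertible_left_inverse)
  then have "D ** matrix_inv D = mat 1 \<and> matrix_inv D ** D = mat 1"
    unfolding invertible_def matrix_inv_def by (rule someI_ex)
  then show 1: "matrix_inv D ** D = mat 1" and 2: "D ** matrix_inv D = mat 1"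
    by auto
  have "D ** transpose (matrix_inv D) = mat 1"
    using arg_cong[OF 1, of transpose] assms
    by (simp add: matrix_transpose_mul transpose_mat pos_def_def)
  then show "transpose (matrix_inv D) = matrix_inv D"
    by (metis 1 matrix_mul_assoc matrix_mul_lid matrix_mul_rid)
qed

text \<open>The constant is the minimum of the form on the compact unit sphere; scaling extends the
  bound to all vectors. Through it the hitting cost controls the squared norm of a deviation from
  the minimizer.\<close>

lemma pos_def_coercive:
  fixes A :: "real ^ 'n ^ 'n"
  assumes "pos_def A"
  obtains c where "c > 0" "\<And>x. c * (norm x)\<^sup>2 \<le> x \<bullet> (A *v x)"
proof -
  have "\<exists>u\<in>sphere (0::real^'n) 1. \<forall>x\<in>sphere 0 1. u \<bullet> (A *v u) \<le> x \<bullet> (A *v x)"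
    by (intro continuous_attains_inf compact_sphere continuous_intros
        matrix_vector_mult_linear_continuous_on) simp
  then obtain u :: "real^'n" where u: "u \<in> sphere 0 1"
    "\<And>x. x \<in> sphere 0 1 \<Longrightarrow> u \<bullet> (A *v u) \<le> x \<bullet> (A *v x)"
    by blast
  show thesis
  proof
    have "u \<noteq> 0" using u(1) by auto
    then show "u \<bullet> (A *v u) > 0" using assms unfolding pos_def_def by blast
    fix x :: "real^'n"
    show "(u \<bullet> (A *v u)) * (norm x)\<^sup>2 \<le> x \<bullet> (A *v x)"
    proof (cases "x = 0")
      case False
      have "x /\<^sub>R norm x \<in> sphere 0 1" using False by simp
      then have "u \<bullet> (A *v u) \<le> (x /\<^sub>R norm x) \<bullet> (A *v (x /\<^sub>R norm x))"
        by (rule u(2))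
      also have "\<dots> = (x \<bullet> (A *v x)) / (norm x)\<^sup>2"
        using False by (simp add: matrix_vector_mult_scaleR power2_eq_square divide_simps)
      finally show ?thesis using False by (simp add: pos_le_divide_eq)
    qed simp
  qed
qed

text \<open>As \<open>C\<close> is at most the identity in the Loewner order, the matrix dominates I
  + A. The choice C = I covers the initial denominator I + A, so base case and recursion share this
  lemma.\<close>

lemma pos_def_mat_2_diff:
  fixes A C :: "real ^ 'n ^ 'n"
  assumes "pos_def A" "transpose C = C" "\<And>x. x \<bullet> (C *v x) \<le> x \<bullet> x"
  shows "x \<bullet> x \<le> x \<bullet> ((2 *\<^sub>R mat 1 + A - C) *v x)"
    and "pos_def (2 *\<^sub>R mat 1 + A - C)"
proof -
  have eq: "x \<bullet> ((2 *\<^sub>R mat 1 + A - C) *v x) = 2 * (x \<bullet> x) + x \<bullet> (A *v x) - x \<bullet> (C *v x)" for x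
    by (simp add: matrix_vector_mult_add_rdistrib matrix_vector_mult_diff_rdistrib
        scaleR_matrix_vector_assoc[symmetric] inner_add_right inner_diff_right)
  show "x \<bullet> x \<le> x \<bullet> ((2 *\<^sub>R mat 1 + A - C) *v x)"
    using pos_def_nonneg[OF assms(1), of x] assms(3)[of x] eq[of x] by linarith
  have "transpose (2 *\<^sub>R mat 1 + A - C) = 2 *\<^sub>R mat 1 + A - C"
    using assms(1,2) by (simp add: vec_eq_iff transpose_def pos_def_def mat_def)
  moreover have "x \<bullet> ((2 *\<^sub>R mat 1 + A - C) *v x) > 0" if "x \<noteq> 0" for x
  proof -
    have "x \<bullet> (A *v x) > 0" using assms(1) that by (simp add: pos_def_def)
    moreover have "0 \<le> x \<bullet> x" by simp
    ultimately show ?thesis using assms(3)[of x] unfolding eq by linarith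
  qed
  ultimately show "pos_def (2 *\<^sub>R mat 1 + A - C)" by (simp add: pos_def_def)
qed

text \<open>For y = D^(-1) x the hypothesis reads y.y <= x.y, which gives the lower bound; combined
  with |x - y|^2 >= 0 it gives the upper one. This carries 0 <= C <= I through one step of the
  recursion.\<close>

lemma matrix_inv_bounds:
  fixes D :: "real ^ 'n ^ 'n"
  assumes "pos_def D" "\<And>x. x \<bullet> x \<le> x \<bullet> (D *v x)"
  shows "0 \<le> x \<bullet> (matrix_inv D *v x)" "x \<bullet> (matrix_inv D *v x) \<le> x \<bullet> x"
proof -
  define y where "y = matrix_inv D *v x"
  have x: "D *v y = x"
    using pos_def_matrix_inv_right[OF assms(1)] by (simp add: y_def matrix_vector_mul_assoc)
  have 1: "y \<bullet> y \<le> x \<bullet> y" using assms(2)[of y] by (simp add: x inner_commute)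
  then show "0 \<le> x \<bullet> (matrix_inv D *v x)"
    using inner_ge_zero[of y] unfolding y_def[symmetric] by linarith
  have "0 \<le> (x - y) \<bullet> (x - y)" by simp
  then have "x \<bullet> y * 2 \<le> x \<bullet> x + y \<bullet> y"
    by (simp add: inner_diff_left inner_diff_right inner_commute)
  then show "x \<bullet> (matrix_inv D *v x) \<le> x \<bullet> x"
    using 1 unfolding y_def[symmetric] by linarith
qed

text \<open>Completing the square: with \<open>a = matrix_inv D *v x\<close> and \<open>b = matrix_inv E *v x\<close>,
  expand \<open>0 \<le> (a - b) \<bullet> (D *v (a - b))\<close>.\<close>

lemma matrix_inv_antimono:
  fixes D E :: "real ^ 'n ^ 'n"
  assumes "pos_def D" "pos_def E" "\<And>x. x \<bullet> (D *v x) \<le> x \<bullet> (E *v x)"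
  shows "x \<bullet> (matrix_inv E *v x) \<le> x \<bullet> (matrix_inv D *v x)"
proof -
  define a b where "a = matrix_inv D *v x" and "b = matrix_inv E *v x"
  have a: "D *v a = x" and b: "E *v b = x"
    using pos_def_matrix_inv_right[OF assms(1)] pos_def_matrix_inv_right[OF assms(2)]
    by (simp_all add: a_def b_def matrix_vector_mul_assoc)
  have "0 \<le> (a - b) \<bullet> (D *v (a - b))"
    by (rule pos_def_nonneg[OF assms(1)])
  also have "\<dots> = a \<bullet> x - 2 * (b \<bullet> x) + b \<bullet> (D *v b)"
    using inner_sym_matrix[of D a b] assms(1) a
    by (simp add: pos_def_def matrix_vector_mult_diff_distrib inner_diff_left inner_diff_right
        inner_commute)
  also have "\<dots> \<le> a \<bullet> x - b \<bullet> x" using assms(3)[of b] b by simp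
  finally show ?thesis unfolding a_def b_def by (simp add: inner_commute)
qed

section \<open>Loewner bounds and monotonicity of the backward recursion\<close>

lemma lai_back_props:
  fixes A :: "real ^ 'n ^ 'n"
  assumes "pos_def A"
  shows "transpose (lai_back A k) = lai_back A k"
    and "0 \<le> x \<bullet> (lai_back A k *v x)"
    and "x \<bullet> (lai_back A k *v x) \<le> x \<bullet> x"
proof -
  have "transpose (lai_back A k) = lai_back A k \<and>
      (\<forall>x. 0 \<le> x \<bullet> (lai_back A k *v x) \<and> x \<bullet> (lai_back A k *v x) \<le> x \<bullet> x)"
  proof (induction k)
    case 0
    \<comment> \<open>The initial denominator is the recursive one for C = I, the virtual matrix
      C_(T+1).\<close>
    have eq: "mat 1 + A = 2 *\<^sub>R mat 1 + A - mat 1" by (simp add: vec_eq_iff)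
    have "transpose (mat 1 :: real^'n^'n) = mat 1" by (simp add: transpose_mat)
    note * = pos_def_mat_2_diff[OF assms this, folded eq]
    from *(2) have D: "pos_def (mat 1 + A)" by simp
    from *(1) have "x \<bullet> x \<le> x \<bullet> ((mat 1 + A) *v x)" for x by simp
    from matrix_inv_bounds[OF D this] show ?case
      using transpose_matrix_inv_pos_def[OF D] by simp
  next
    case (Suc k)
    then have C: "transpose (lai_back A k) = lai_back A k"
      "\<And>x. x \<bullet> (lai_back A k *v x) \<le> x \<bullet> x" by auto
    note * = pos_def_mat_2_diff[OF assms C]
    from matrix_inv_bounds[OF *(2,1)] show ?case
      using transpose_matrix_inv_pos_def[OF *(2)] by simp
  qed
  then show "transpose (lai_back A k) = lai_back A k" "0 \<le> x \<bullet> (lai_back A k *v x)"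
    "x \<bullet> (lai_back A k *v x) \<le> x \<bullet> x" by auto
qed

lemma pos_def_lai_back_denom:
  fixes A :: "real ^ 'n ^ 'n"
  assumes "pos_def A"
  shows "pos_def (mat 1 + A)" "pos_def (2 *\<^sub>R mat 1 + A - lai_back A k)"
proof -
  have eq: "mat 1 + A = 2 *\<^sub>R mat 1 + A - mat 1" by (simp add: vec_eq_iff)
  show "pos_def (mat 1 + A)" unfolding eq
    by (rule pos_def_mat_2_diff[OF assms]) (simp_all add: transpose_mat)
  show "pos_def (2 *\<^sub>R mat 1 + A - lai_back A k)"
    by (rule pos_def_mat_2_diff[OF assms]) (simp_all add: lai_back_props[OF assms])
qed

text \<open>Inversion reverses the Loewner order, so C |-> (2 I + A - C)^(-1) preserves it. The
  first comparison amounts to \<open>lai_back A 0\<close> being at most I, and the induction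
  propagates it.\<close>

lemma lai_back_decreasing:
  fixes A :: "real ^ 'n ^ 'n"
  assumes "pos_def A"
  shows "x \<bullet> (lai_back A (Suc k) *v x) \<le> x \<bullet> (lai_back A k *v x)"
proof (induction k arbitrary: x)
  case 0
  show ?case
    unfolding lai_back.simps(2) lai_back.simps(1)[of A]
    using lai_back_props(3)[OF assms, of _ 0] pos_def_lai_back_denom(2)[OF assms, of 0]
    by (intro matrix_inv_antimono pos_def_lai_back_denom assms)
      (simp_all add: algebra_simps scaleR_matrix_vector_assoc[symmetric] 
        matrix_vector_mult_add_rdistrib matrix_vector_mult_diff_rdistrib)
next
  case (Suc k)
  show ?case
    unfolding lai_back.simps(2)[of A "Suc k"] lai_back.simps(2)[of A k]
    using Suc
    by (intro matrix_inv_antimono pos_def_lai_back_denom(2)[OF assms, of "Suc k", simplified]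
        pos_def_lai_back_denom assms)
      (simp_all add: matrix_vector_mult_add_rdistrib matrix_vector_mult_diff_rdistrib 
        inner_diff_right inner_add_right)
qed

text \<open>The trace of \<open>transpose X ** (S ** X + X ** R)\<close> is the sum of the values of the quadratic
  form of \<open>S\<close> on the columns of \<open>X\<close> and that of \<open>R\<close> on its rows.\<close>

lemma Sylvester_zero:
  fixes S R X :: "real ^ 'n ^ 'n"
  assumes "pos_def S" "pos_def R" "S ** X + X ** R = 0"
  shows "X = 0"
proof -
  have tr: "trace (transpose Y ** (B ** Y)) = (\<Sum>i\<in>UNIV. column i Y \<bullet> (B *v column i Y))"
    for B Y :: "real^'n^'n"
    by (simp add: trace_def matrix_matrix_mult_def transpose_def column_def inner_vec_def
        matrix_vector_mult_def)
  have "trace (transpose X ** (X ** R)) = trace (X ** (R ** transpose X))"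
    by (metis matrix_mul_assoc trace_mul_sym)
  also have "\<dots> = (\<Sum>i\<in>UNIV. column i (transpose X) \<bullet> (R *v column i (transpose X)))"
    using tr[of "transpose X" R] by simp
  also have "\<dots> \<ge> 0" using pos_def_nonneg[OF assms(2)] by (intro sum_nonneg) auto
  finally have 1: "trace (transpose X ** (X ** R)) \<ge> 0" .
  have "trace (transpose X ** (S ** X)) + trace (transpose X ** (X ** R)) =
      trace (transpose X ** (S ** X + X ** R))"
    by (simp add: matrix_add_ldistrib trace_add)
  also have "\<dots> = 0" unfolding assms(3) by (simp add: matrix_matrix_mult_def trace_def)
  finally have "trace (transpose X ** (S ** X)) \<le> 0" using 1 by linarith
  then have "(\<Sum>i\<in>UNIV. column i X \<bullet> (S *v column i X)) = 0"
    unfolding tr using pos_def_nonneg[OF assms(1)] by (intro antisym sum_nonneg) auto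
  then have "column i X \<bullet> (S *v column i X) = 0" for i
    using pos_def_nonneg[OF assms(1)] by (simp add: sum_nonneg_eq_0_iff)
  then have "column i X = 0" for i
    using assms(1) unfolding pos_def_def by (metis less_irrefl)
  then show "X = 0" by (simp add: column_def vec_eq_iff)
qed

lemma matrix_diff_ldistrib:
  fixes A B C :: "real ^ 'n ^ 'n"
  shows "A ** (B - C) = A ** B - A ** C"
  by (simp add: matrix_matrix_mult_def vec_eq_iff right_diff_distrib sum_subtractf)

lemma matrix_diff_rdistrib:
  fixes A B C :: "real ^ 'n ^ 'n"
  shows "(A - B) ** C = A ** C - B ** C"
  by (simp add: matrix_matrix_mult_def vec_eq_iff left_diff_distrib sum_subtractf)

lemma matrix_add_rdistrib:
  fixes A B C :: "real ^ 'n ^ 'n"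
  shows "(A + B) ** C = A ** C + B ** C"
  by (simp add: matrix_matrix_mult_def vec_eq_iff distrib_right sum.distrib)

lemma transpose_add:
  fixes A B :: "real ^ 'n ^ 'm"
  shows "transpose (A + B) = transpose A + transpose B"
  by (simp add: transpose_def vec_eq_iff)

text \<open>A definite description can be evaluated only once uniqueness is known. For two roots S
  and R the expression S (S - R) + (S - R) R collapses to S^2 - R^2 = 0.\<close>

lemma mat_sqrt_eqI:
  assumes "pos_def S" "S ** S = M"
  shows "mat_sqrt M = S"
  unfolding mat_sqrt_def
proof (rule the_equality)
  fix R assume R: "pos_def R \<and> R ** R = M"
  have "S ** (S - R) + (S - R) ** R = 0"
    using R assms(2) by (simp add: matrix_diff_ldistrib matrix_diff_rdistrib)
  then have "S - R = 0" using assms(1) R Sylvester_zero by blast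
  then show "R = S" by simp
qed (use assms in simp)

section \<open>Convergence of the recursion and identification of the limit\<close>

lemma lai_back_convergent:
  fixes A :: "real ^ 'n ^ 'n"
  assumes "pos_def A"
  shows "convergent (lai_back A)"
proof -
  \<comment> \<open>For fixed \<open>x\<close> the values decrease and stay between 0 and
    x.x.\<close>
  have q: "convergent (\<lambda>k. x \<bullet> (lai_back A k *v x))" for x
  proof (rule Bseq_monoseq_convergent)
    show "Bseq (\<lambda>k. x \<bullet> (lai_back A k *v x))"
      using lai_back_props[OF assms] by (intro BseqI'[of _ "x \<bullet> x"]) auto
    show "monoseq (\<lambda>k. x \<bullet> (lai_back A k *v x))"
      using lai_back_decreasing[OF assms] by (auto simp: monoseq_Suc)
  qed
  have "convergent (\<lambda>k. lai_back A k $ i $ j)" for i j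
  proof -
    \<comment> \<open>Polarization: by symmetry an entry is determined by three values of the
      quadratic form.\<close>
    have entry: "lai_back A k $ i $ j = 1/2 * ((axis i 1 + axis j 1) \<bullet> (lai_back A k *v (axis i 1 + axis j 1))
       - axis i 1 \<bullet> (lai_back A k *v axis i 1) - axis j 1 \<bullet> (lai_back A k *v axis j 1))" for k
    proof -
      have "axis i 1 \<bullet> (lai_back A k *v axis j 1) = lai_back A k $ i $ j"
        by (simp add: inner_axis' matrix_vector_mul_component inner_axis)
      moreover have "axis j 1 \<bullet> (lai_back A k *v axis i 1) = axis i 1 \<bullet> (lai_back A k *v axis j 1)"
        by (metis inner_sym_matrix inner_commute lai_back_props(1)[OF assms])
      ultimately show ?thesis
        by (simp add: matrix_vector_right_distrib inner_add_left inner_add_right)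
    qed
    show ?thesis unfolding entry
      by (intro convergent_mult convergent_diff convergent_const q)
  qed
  then obtain L where "\<And>i j. (\<lambda>k. lai_back A k $ i $ j) \<longlonglongrightarrow> L i j"
    unfolding convergent_def by metis
  then have "lai_back A \<longlonglongrightarrow> (\<chi> i j. L i j)"
    by (intro vec_tendstoI) simp
  then show ?thesis by (rule convergentI)
qed

lemma lai_back_tendsto_C_L:
  fixes A :: "real ^ 'n ^ 'n"
  assumes "pos_def A"
  shows "lai_back A \<longlonglongrightarrow> C_L A"
proof -
  obtain C where C: "lai_back A \<longlonglongrightarrow> C"
    using lai_back_convergent[OF assms] by (auto simp: convergent_def)
  have Cij: "(\<lambda>k. lai_back A k $ i $ j) \<longlonglongrightarrow> C $ i $ j" for i j
    by (intro tendsto_vec_nth C)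
  have quad: "(\<lambda>k. x \<bullet> (lai_back A k *v x)) \<longlonglongrightarrow> x \<bullet> (C *v x)" for x
    unfolding inner_vec_def matrix_vector_mult_def by (auto intro!: tendsto_intros Cij)
  have symC: "transpose C = C"
  proof -
    have "C $ i $ j = C $ j $ i" for i j
    proof -
      have "lai_back A k $ i $ j = lai_back A k $ j $ i" for k
        using arg_cong[OF lai_back_props(1)[OF assms, of k], of "\<lambda>B. B $ j $ i"]
        by (simp add: transpose_def)
      then show ?thesis using LIMSEQ_unique[OF Cij[of i j]] Cij[of j i] by simp
    qed
    then show ?thesis by (simp add: transpose_def vec_eq_iff)
  qed
  have C_le: "x \<bullet> (C *v x) \<le> x \<bullet> x" for x
    using lai_back_props(3)[OF assms] by (intro LIMSEQ_le_const2[OF quad]) auto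
  define B where "B = 2 *\<^sub>R mat 1 + A"
  have symB: "transpose B = B"
    using assms by (simp add: B_def vec_eq_iff transpose_def pos_def_def mat_def)
  \<comment> \<open>Cleared of the inverse, the recursion is polynomial in the entries and passes to
    the limit.\<close>
  have "C ** (B - C) = mat 1"
  proof -
    have "(\<lambda>k. (lai_back A (Suc k) ** (B - lai_back A k)) $ i $ j) \<longlonglongrightarrow> (C ** (B - C)) $ i $ j" for i j
      unfolding matrix_matrix_mult_def
      by (auto intro!: tendsto_intros Cij LIMSEQ_Suc[OF Cij] simp del: lai_back.simps)
    moreover have "lai_back A (Suc k) ** (B - lai_back A k) = mat 1" for k
      using pos_def_matrix_inv_left[OF pos_def_lai_back_denom(2)[OF assms, of k]] by (simp add: B_def)
    ultimately show ?thesis by (simp add: vec_eq_iff LIMSEQ_const_iff)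
  qed
  then have CB: "C ** B = mat 1 + C ** C"
    by (simp add: matrix_diff_ldistrib algebra_simps)
  then have BC: "B ** C = mat 1 + C ** C"
    by (metis symB symC matrix_transpose_mul transpose_add transpose_mat)
  \<comment> \<open>Solving the formula of \<open>C_L\<close> for the root gives this candidate. In
    its square the mixed products contribute -4 (I + C^2), the squares of \<open>C\<close> cancel,
    and B^2 - 4 I = A^2 + 4 A remains.\<close>
  define S where "S = B - 2 *\<^sub>R C"
  have B2: "B = mat 1 + mat 1 + A" by (simp add: B_def vec_eq_iff)
  have "S = B - C - C" by (simp add: S_def vec_eq_iff)
  then have "S ** S = (B - C - C) ** (B - C - C)" by simp
  also have "\<dots> = B ** B - (B ** C + B ** C) - (C ** B + C ** B)
      + (C ** C + C ** C + C ** C + C ** C)"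
    unfolding matrix_diff_ldistrib matrix_diff_rdistrib by (simp add: vec_eq_iff)
  also have "\<dots> = B ** B - 4 *\<^sub>R mat 1" unfolding BC CB by (simp add: vec_eq_iff)
  also have "\<dots> = A ** A + 4 *\<^sub>R A"
    unfolding B2 matrix_add_ldistrib matrix_add_rdistrib by (simp add: vec_eq_iff)
  finally have SS: "S ** S = A ** A + 4 *\<^sub>R A" .
  \<comment> \<open>The form is 2 (x.x - x.Cx) + x.Ax, whose first part is nonnegative because C <=
    I.\<close>
  have "pos_def S"
  proof -
    have "transpose S = S"
      using symB symC by (simp add: S_def vec_eq_iff transpose_def)
    moreover have "x \<bullet> (S *v x) > 0" if "x \<noteq> 0" for x
    proof -
      have "x \<bullet> (S *v x) = 2 * (x \<bullet> x) + x \<bullet> (A *v x) - 2 * (x \<bullet> (C *v x))"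
        unfolding S_def B_def
        by (simp add: matrix_vector_mult_add_rdistrib matrix_vector_mult_diff_rdistrib
          scaleR_matrix_vector_assoc[symmetric] inner_add_right inner_diff_right)
      moreover have "x \<bullet> (A *v x) > 0" using assms that by (simp add: pos_def_def)
      ultimately show ?thesis using C_le[of x] by linarith
    qed
    ultimately show ?thesis by (simp add: pos_def_def)
  qed
  then have "mat_sqrt (A ** A + 4 *\<^sub>R A) = S" using SS by (rule mat_sqrt_eqI)
  then have "C_L A = C"
    unfolding C_L_def S_def B_def by (simp add: vec_eq_iff)
  then show ?thesis using C by simp
qed

text \<open>A decreasing sequence stays above its limit. The final cost bound rests on this
  comparison.\<close>

lemma C_L_le_lai_back:
  fixes A :: "real ^ 'n ^ 'n"
  assumes "pos_def A"
  shows "x \<bullet> (C_L A *v x) \<le> x \<bullet> (lai_back A k *v x)"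
proof (rule decseq_ge)
  show "decseq (\<lambda>k. x \<bullet> (lai_back A k *v x))"
    using lai_back_decreasing[OF assms] by (auto simp: decseq_Suc_iff)
  show "(\<lambda>k. x \<bullet> (lai_back A k *v x)) \<longlonglongrightarrow> x \<bullet> (C_L A *v x)"
    unfolding inner_vec_def matrix_vector_mult_def
    by (auto intro!: tendsto_intros lai_back_tendsto_C_L assms)
qed

text \<open>Read w = x_t - v_t, u = x_(t-1) - v_t and C' = C_(t+1): hitting cost, switching cost and
  remaining value add up to 1/2 w.Dw - w.u + 1/2 u.u. With C = D^(-1), completing the square gives
  the minimizer w = C u.\<close>

lemma cost_step:
  fixes A C C' :: "real ^ 'n ^ 'n"
  defines "D \<equiv> 2 *\<^sub>R mat 1 + A - C'"
  assumes "transpose D = D" "D ** C = mat 1"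
  shows "1/2 * (w \<bullet> (A *v w)) + 1/2 * (norm (w - u))\<^sup>2 + 1/2 * (w \<bullet> ((mat 1 - C') *v w)) =
    1/2 * (u \<bullet> ((mat 1 - C) *v u)) + 1/2 * ((w - C *v u) \<bullet> (D *v (w - C *v u)))"
proof -
  have DC: "D *v (C *v z) = z" for z using assms(3) by (simp add: matrix_vector_mul_assoc)
  have "(w - C *v u) \<bullet> (D *v (w - C *v u)) = w \<bullet> (D *v w) - 2 * (w \<bullet> u) + u \<bullet> (C *v u)"
    using inner_sym_matrix[OF assms(2), of "C *v u" w]
    by (simp add: matrix_vector_mult_diff_distrib inner_diff_left inner_diff_right DC
      inner_commute)
  moreover have "w \<bullet> (D *v w) = 2 * (w \<bullet> w) + w \<bullet> (A *v w) - w \<bullet> (C' *v w)"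
    unfolding D_def
    by (simp add: matrix_vector_mult_add_rdistrib matrix_vector_mult_diff_rdistrib
        scaleR_matrix_vector_assoc[symmetric] inner_add_right inner_diff_right)
  moreover have "(norm (w - u))\<^sup>2 = w \<bullet> w - 2 * (w \<bullet> u) + u \<bullet> u"
    by (simp add: power2_norm_eq_inner inner_diff_left inner_diff_right inner_commute)
  ultimately show ?thesis
    by (simp add: matrix_vector_mult_diff_rdistrib inner_diff_right field_simps)
qed

subsection \<open>Square integrability and martingale increments\<close>

definition square_integrable :: "'w measure \<Rightarrow> ('w \<Rightarrow> real ^ 'n) \<Rightarrow> bool" where
  "square_integrable M X \<longleftrightarrow> X \<in> borel_measurable M \<and> integrable M (\<lambda>\<omega>. (norm (X \<omega>))\<^sup>2)"

lemma borel_measurable_matrix_vector [measurable (raw)]: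
  fixes A :: "real ^ 'n ^ 'm"
  assumes "X \<in> borel_measurable M"
  shows "(\<lambda>\<omega>. A *v X \<omega>) \<in> borel_measurable M"
  using assms borel_measurable_continuous_on[OF matrix_vector_mult_linear_continuous_on] by blast

lemma square_integrable_inner:
  fixes X Y :: "'w \<Rightarrow> real ^ 'n"
  assumes "square_integrable M X" "square_integrable M Y"
  shows "integrable M (\<lambda>\<omega>. X \<omega> \<bullet> Y \<omega>)"
proof (rule Bochner_Integration.integrable_bound)
  show "integrable M (\<lambda>\<omega>. (norm (X \<omega>))\<^sup>2 + (norm (Y \<omega>))\<^sup>2)"
    using assms by (auto simp: square_integrable_def)
  have [measurable]: "X \<in> borel_measurable M" "Y \<in> borel_measurable M"
    using assms by (auto simp: square_integrable_def)
  show "(\<lambda>\<omega>. X \<omega> \<bullet> Y \<omega>) \<in> borel_measurable M" by measurable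
  have "\<bar>x \<bullet> y\<bar> \<le> (norm x)\<^sup>2 + (norm y)\<^sup>2" for x y :: "real ^ 'n"
  proof -
    have "\<bar>x \<bullet> y\<bar> \<le> norm x * norm y" by (rule Cauchy_Schwarz_ineq2)
    also have "\<dots> \<le> (norm x)\<^sup>2 + (norm y)\<^sup>2"
      using sum_squares_bound[of "norm x" "norm y"] mult_nonneg_nonneg[of "norm x" "norm y"]
      by (simp del: mult_nonneg_nonneg)
    finally show ?thesis .
  qed
  then show "AE \<omega> in M. norm (X \<omega> \<bullet> Y \<omega>) \<le> norm ((norm (X \<omega>))\<^sup>2 + (norm (Y \<omega>))\<^sup>2)"
    by simp
qed

lemma square_integrable_diff:
  fixes X Y :: "'w \<Rightarrow> real ^ 'n"
  assumes "square_integrable M X" "square_integrable M Y"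
  shows "square_integrable M (\<lambda>\<omega>. X \<omega> - Y \<omega>)"
proof -
  have [measurable]: "X \<in> borel_measurable M" "Y \<in> borel_measurable M"
    using assms by (auto simp: square_integrable_def)
  have "integrable M (\<lambda>\<omega>. X \<omega> \<bullet> X \<omega> - 2 * (X \<omega> \<bullet> Y \<omega>) + Y \<omega> \<bullet> Y \<omega>)"
    using assms square_integrable_inner by (intro Bochner_Integration.integrable_add
      Bochner_Integration.integrable_diff integrable_mult_right) auto
  moreover have "(norm (X \<omega> - Y \<omega>))\<^sup>2 = X \<omega> \<bullet> X \<omega> - 2 * (X \<omega> \<bullet> Y \<omega>) + Y \<omega> \<bullet> Y \<omega>" for \<omega>
    by (simp add: power2_norm_eq_inner inner_diff_left inner_diff_right inner_commute)
  ultimately show ?thesis by (simp add: square_integrable_def)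
qed

lemma square_integrable_matrix_vector:
  fixes A :: "real ^ 'n ^ 'n"
  assumes "square_integrable M X"
  shows "square_integrable M (\<lambda>\<omega>. A *v X \<omega>)"
proof -
  have [measurable]: "X \<in> borel_measurable M" and int: "integrable M (\<lambda>\<omega>. (norm (X \<omega>))\<^sup>2)"
    using assms by (auto simp: square_integrable_def)
  have bound: "(norm (A *v x))\<^sup>2 \<le> (onorm ((*v) A))\<^sup>2 * (norm x)\<^sup>2" for x
    using onorm[OF matrix_vector_mul_bounded_linear[of A], of x]
    by (metis norm_ge_zero power_mono power_mult_distrib)
  have "integrable M (\<lambda>\<omega>. (norm (A *v X \<omega>))\<^sup>2)"
    by (rule Bochner_Integration.integrable_bound
        [OF integrable_mult_right[OF int, of "(onorm ((*v) A))\<^sup>2"]]) (use bound in auto)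
  then show ?thesis by (simp add: square_integrable_def)
qed

lemma square_integrable_component:
  assumes "square_integrable M X"
  shows "(\<lambda>\<omega>. X \<omega> $ i) \<in> borel_measurable M" "integrable M (\<lambda>\<omega>. (X \<omega> $ i)\<^sup>2)"
proof -
  have [measurable]: "X \<in> borel_measurable M" and int: "integrable M (\<lambda>\<omega>. (norm (X \<omega>))\<^sup>2)"
    using assms by (auto simp: square_integrable_def)
  have "(\<lambda>\<omega>. X \<omega> \<bullet> axis i 1) \<in> borel_measurable M" by measurable
  then show [measurable]: "(\<lambda>\<omega>. X \<omega> $ i) \<in> borel_measurable M" by (simp add: inner_axis)
  have bound: "(x $ i)\<^sup>2 \<le> (norm x)\<^sup>2" for x :: "real ^ 'b"
    using component_le_norm_cart[of x i] by (metis abs_ge_zero power2_abs power_mono)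
  show "integrable M (\<lambda>\<omega>. (X \<omega> $ i)\<^sup>2)"
    by (rule Bochner_Integration.integrable_bound[OF int]) (use bound in auto)
qed

lemma square_integrable_component_mult:
  assumes "square_integrable M X" "square_integrable M Y"
  shows "integrable M (\<lambda>\<omega>. X \<omega> $ i * Y \<omega> $ i)"
proof (rule Bochner_Integration.integrable_bound)
  note [measurable] = square_integrable_component(1)[OF assms(1)] square_integrable_component(1)[OF assms(2)]
  show "integrable M (\<lambda>\<omega>. (X \<omega> $ i)\<^sup>2 + (Y \<omega> $ i)\<^sup>2)"
    using assms square_integrable_component(2) by (intro Bochner_Integration.integrable_add) auto
  show "(\<lambda>\<omega>. X \<omega> $ i * Y \<omega> $ i) \<in> borel_measurable M" by measurable
  have "\<bar>x * y\<bar> \<le> x\<^sup>2 + y\<^sup>2" for x y :: real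
    using sum_squares_bound[of x y] sum_squares_bound[of x "-y"] by (auto simp: abs_if)
  then show "AE \<omega> in M. norm (X \<omega> $ i * Y \<omega> $ i) \<le> norm ((X \<omega> $ i)\<^sup>2 + (Y \<omega> $ i)\<^sup>2)" by simp
qed

text \<open>The squared norm is the sum of the diagonal second moments.\<close>

lemma square_integrable_finite_covariance:
  assumes "finite_covariance M X" "X \<in> borel_measurable M"
  shows "square_integrable M X"
  using assms by (simp add: square_integrable_def finite_covariance_def power2_norm_eq_inner inner_vec_def)

lemma square_integrable_increment:
  fixes v :: "nat \<Rightarrow> 'w \<Rightarrow> real ^ 'n"
  assumes v0: "v 0 = (\<lambda>_. x0)"
    and v: "\<And>t. t \<in> {1..T} \<Longrightarrow> v t \<in> borel_measurable M"
    and cov: "\<And>t. t \<in> {1..T} \<Longrightarrow> finite_covariance M (\<lambda>\<omega>. v t \<omega> - v (t - 1) \<omega>)"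
    and t: "t \<in> {1..T}"
  shows "square_integrable M (\<lambda>\<omega>. v t \<omega> - v (t - 1) \<omega>)"
proof -
  have "v (t - 1) \<in> borel_measurable M"
  \<comment> \<open>Measurability is assumed from index 1 on; for t = 1 the predecessor is the
    constant starting point.\<close>
  proof (cases "t - 1 = 0")
    case False
    then have "t - 1 \<in> {1..T}" using t by auto
    then show ?thesis by (rule v)
  qed (simp add: v0)
  with v[OF t] have "(\<lambda>\<omega>. v t \<omega> - v (t - 1) \<omega>) \<in> borel_measurable M"
    by (rule borel_measurable_diff)
  with cov[OF t] show ?thesis by (rule square_integrable_finite_covariance)
qed

section \<open>The natural filtration and orthogonality of martingale increments\<close>

lemma space_natural_filtration [simp]: "space (natural_filtration M v t) = space M"
  by (simp add: natural_filtration_def space_measure_of_conv)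

lemma sets_natural_filtration:
  "sets (natural_filtration M v t) =
    sigma_sets (space M) (\<Union>i\<in>{1..t}. {v i -` B \<inter> space M | B. B \<in> sets borel})"
  unfolding natural_filtration_def by (rule sets_measure_of) auto

lemma measurable_natural_filtration:
  fixes v :: "nat \<Rightarrow> 'w \<Rightarrow> real ^ 'n"
  assumes "i \<in> {1..t}"
  shows "v i \<in> borel_measurable (natural_filtration M v t)"
proof (rule measurableI)
  fix B :: "(real ^ 'n) set" assume "B \<in> sets borel"
  then show "v i -` B \<inter> space (natural_filtration M v t) \<in> sets (natural_filtration M v t)"
    unfolding sets_natural_filtration space_natural_filtration
    using assms by (intro sigma_sets.Basic) blast
qed simp

lemma subalgebra_natural_filtration:
  assumes "\<And>i. i \<in> {1..t} \<Longrightarrow> v i \<in> borel_measurable M"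
  shows "subalgebra M (natural_filtration M v t)"
  unfolding subalgebra_def sets_natural_filtration space_natural_filtration
  using assms by (auto intro!: sets.sigma_sets_subset measurable_sets)

text \<open>Componentwise, conditioning on time \<open>t\<close> pulls out the factor
  \<open>Z\<close> and leaves a conditional mean zero. The bound \<open>1 \<le> t\<close> matters:
  the martingale starts at v_1, whose mean may differ from x_0.\<close>

lemma (in prob_space) martingale_increment_orthogonal:
  fixes Z :: "'a \<Rightarrow> real ^ 'n"
  assumes mart: "martingale_upto M T v" and t: "1 \<le> t" "Suc t \<le> T"
    and v: "\<And>i. i \<in> {1..T} \<Longrightarrow> v i \<in> borel_measurable M"
    and Z: "Z \<in> borel_measurable (natural_filtration M v t)" "square_integrable M Z"
    and d: "square_integrable M (\<lambda>\<omega>. v (Suc t) \<omega> - v t \<omega>)"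
  shows "(\<integral>\<omega>. Z \<omega> \<bullet> (v (Suc t) \<omega> - v t \<omega>) \<partial>M) = 0"
proof -
  define F where "F = natural_filtration M v t"
  have sub: "subalgebra M F"
    unfolding F_def using t v by (intro subalgebra_natural_filtration) auto
  \<comment> \<open>Conditional expectations need a sigma-finite restriction to \<open>F\<close>,
    which a finite measure provides.\<close>
  then interpret sigma_finite_subalgebra M F
    using finite_measure_axioms
    by (intro finite_measure_subalgebra_is_sigma_finite)
      (simp add: finite_measure_subalgebra_def finite_measure_subalgebra_axioms_def)
  have comp: "(\<lambda>\<omega>. X \<omega> $ i) \<in> borel_measurable N" if "X \<in> borel_measurable N"
    for X :: "'a \<Rightarrow> real ^ 'n" and N i
  proof -
    have "(\<lambda>\<omega>. X \<omega> \<bullet> axis i 1) \<in> borel_measurable N" using that by measurable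
    then show ?thesis by (simp add: inner_axis)
  qed
  have int_v: "integrable M (\<lambda>\<omega>. v s \<omega> $ i)" if "s \<in> {1..T}" for s i
  proof -
    have "integrable M (\<lambda>\<omega>. v s \<omega> \<bullet> axis i 1)"
      using mart that by (intro integrable_inner_left) (auto simp: martingale_upto_def)
    then show ?thesis by (simp add: inner_axis)
  qed
  have "(\<integral>\<omega>. Z \<omega> $ i * (v (Suc t) \<omega> - v t \<omega>) $ i \<partial>M) = 0" for i
  proof -
    have ae: "AE \<omega> in M. real_cond_exp M F (\<lambda>\<omega>. (v (Suc t) \<omega> - v t \<omega>) $ i) \<omega> = 0"
    proof -
      have ms: "AE \<omega> in M. real_cond_exp M F (\<lambda>\<omega>. v s \<omega> $ i) \<omega> = v t \<omega> $ i"
        if "t \<le> s" "s \<le> T" for s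
      proof -
        have "AE \<omega> in M. \<forall>i. real_cond_exp M F (\<lambda>\<omega>. v s \<omega> $ i) \<omega> = v t \<omega> $ i"
          using mart t that unfolding martingale_upto_def F_def by blast
        then show ?thesis by eventually_elim simp
      qed
      have "AE \<omega> in M. real_cond_exp M F (\<lambda>\<omega>. v (Suc t) \<omega> $ i - v t \<omega> $ i) \<omega> =
          real_cond_exp M F (\<lambda>\<omega>. v (Suc t) \<omega> $ i) \<omega> - real_cond_exp M F (\<lambda>\<omega>. v t \<omega> $ i) \<omega>"
        using t by (intro real_cond_exp_diff int_v) auto
      \<comment> \<open>The martingale property at s = t and at s = t + 1; the two values
        cancel.\<close>
      moreover have "AE \<omega> in M. real_cond_exp M F (\<lambda>\<omega>. v t \<omega> $ i) \<omega> = v t \<omega> $ i"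
        "AE \<omega> in M. real_cond_exp M F (\<lambda>\<omega>. v (Suc t) \<omega> $ i) \<omega> = v t \<omega> $ i"
        using ms[of t] ms[of "Suc t"] t by simp_all
      ultimately show ?thesis
        unfolding vector_minus_component by eventually_elim simp
    qed
    \<comment> \<open>Pulling out the measurable factor requires the product to be integrable, which
      both L^2 hypotheses supply.\<close>
    have "(\<integral>\<omega>. Z \<omega> $ i * (v (Suc t) \<omega> - v t \<omega>) $ i \<partial>M) =
        (\<integral>\<omega>. Z \<omega> $ i * real_cond_exp M F (\<lambda>\<omega>. (v (Suc t) \<omega> - v t \<omega>) $ i) \<omega> \<partial>M)"
      using square_integrable_component_mult[OF Z(2) d, of i] Z(1) d
      by (intro real_cond_exp_intg(2)[symmetric] comp) (auto simp: F_def square_integrable_def)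
    also have "\<dots> = 0"
      by (rule integral_eq_zero_AE, use ae in eventually_elim) simp
    finally show ?thesis .
  qed
  then show ?thesis
    using square_integrable_component_mult[OF Z(2) d]
    by (simp add: inner_vec_def Bochner_Integration.integral_sum)
qed

subsection \<open>Decomposition of the cost\<close>

text \<open>\<open>lai_next A T t\<close> is the matrix with index \<open>t + 1\<close> of the recursion, extended by the identity
  at \<open>T + 1\<close>; with this convention the two cases of the recursion become one.\<close>

definition lai_next :: "real ^ 'n ^ 'n \<Rightarrow> nat \<Rightarrow> nat \<Rightarrow> real ^ 'n ^ 'n" where
  "lai_next A T t = (if t < T then lai_C A T (Suc t) else mat 1)"

text \<open>This is C_t^(-1) written without inversion: the Hessian in x_t of the round cost (A and
  I) plus the remaining value (I - C_(t+1)).\<close>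

definition lai_D :: "real ^ 'n ^ 'n \<Rightarrow> nat \<Rightarrow> nat \<Rightarrow> real ^ 'n ^ 'n" where
  "lai_D A T t = 2 *\<^sub>R mat 1 + A - lai_next A T t"

lemma lai_D_last: "lai_D A T T = mat 1 + A"
  by (simp add: lai_D_def lai_next_def vec_eq_iff)

lemma lai_D_less: "t < T \<Longrightarrow> lai_D A T t = 2 *\<^sub>R mat 1 + A - lai_back A (T - Suc t)"
  by (simp add: lai_D_def lai_next_def lai_C_def)

lemma lai_C_eq_inverse:
  assumes "t \<le> T"
  shows "lai_C A T t = matrix_inv (lai_D A T t)"
proof (cases "t = T")
  case True
  then show ?thesis by (simp add: lai_C_def lai_D_last)
next
  case False
  \<comment> \<open>Truncated subtraction: only for t < T does this expose the recursive clause of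
    \<open>lai_back\<close>.\<close>
  then have "T - t = Suc (T - Suc t)" using assms by simp
  then show ?thesis using False assms by (simp add: lai_C_def lai_D_less)
qed

lemma pos_def_lai_D:
  assumes "pos_def A" "t \<le> T"
  shows "pos_def (lai_D A T t)"
  using assms pos_def_lai_back_denom[OF assms(1)]
  by (cases "t = T") (simp_all add: lai_D_last lai_D_less)

text \<open>The completed square is applied once per round, and the value terms telescope.\<close>

lemma total_cost_decomposition:
  fixes v x :: "nat \<Rightarrow> 'w \<Rightarrow> real ^ 'n"
  assumes A: "pos_def A" and x0: "x 0 \<omega> = v 0 \<omega>"
  shows "total_cost A T v x \<omega> = (\<Sum>t=1..T.
      1/2 * ((v t \<omega> - v (t - 1) \<omega>) \<bullet> ((mat 1 - lai_C A T t) *v (v t \<omega> - v (t - 1) \<omega>)))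
      - ((mat 1 - lai_C A T t) *v (x (t - 1) \<omega> - v (t - 1) \<omega>)) \<bullet> (v t \<omega> - v (t - 1) \<omega>)
      + 1/2 * ((x t \<omega> - v t \<omega> - lai_C A T t *v (x (t - 1) \<omega> - v t \<omega>)) \<bullet>
          (lai_D A T t *v (x t \<omega> - v t \<omega> - lai_C A T t *v (x (t - 1) \<omega> - v t \<omega>)))))"
    (is "_ = (\<Sum>t=1..T. ?term t)")
proof -
  define w where "w t = x t \<omega> - v t \<omega>" for t
  define d where "d t = v t \<omega> - v (t - 1) \<omega>" for t
  let ?cost = "\<lambda>t. hitting_cost A (v t \<omega>) (x t \<omega>) + 1/2 * (norm (x t \<omega> - x (t - 1) \<omega>))\<^sup>2"
  \<comment> \<open>The invariant keeps the value term at time \<open>n\<close>. It vanishes at n =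
    0 because w_0 = 0, and at n = T because \<open>lai_next\<close> is the identity there.\<close>
  have "(\<Sum>t=1..n. ?cost t) + 1/2 * (w n \<bullet> ((mat 1 - lai_next A T n) *v w n)) = (\<Sum>t=1..n. ?term t)"
    if "n \<le> T" for n
    using that
  proof (induction n)
    case 0
    then show ?case using x0 by (simp add: w_def)
  next
    case (Suc n)
    define C where "C = lai_C A T (Suc n)"
    define D where "D = lai_D A T (Suc n)"
    define u where "u = x n \<omega> - v (Suc n) \<omega>"
    have pd: "pos_def D" and C_eq: "C = matrix_inv D"
      using Suc.prems A by (auto simp: C_def D_def pos_def_lai_D lai_C_eq_inverse)
    have DC: "transpose D = D" "D ** C = mat 1" and symC: "transpose C = C"
      using pd pos_def_matrix_inv_right[OF pd] transpose_matrix_inv_pos_def[OF pd]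
      by (simp_all add: pos_def_def C_eq)
    have symP: "transpose (mat 1 - C) = mat 1 - C"
      using symC by (simp add: transpose_def vec_eq_iff mat_def)
    have next_n: "lai_next A T n = C" using Suc.prems by (simp add: lai_next_def C_def)
    have u: "u = w n - d (Suc n)" by (simp add: u_def w_def d_def)
    \<comment> \<open>Revealing the next minimizer shifts w_n to w_n - d_(n+1); expanding creates
      the cross term.\<close>
    have "u \<bullet> ((mat 1 - C) *v u) = w n \<bullet> ((mat 1 - C) *v w n)
        - 2 * (((mat 1 - C) *v w n) \<bullet> d (Suc n)) + d (Suc n) \<bullet> ((mat 1 - C) *v d (Suc n))"
      using inner_sym_matrix[OF symP, of "w n" "d (Suc n)"]
      unfolding u matrix_vector_mult_diff_distrib inner_diff_left inner_diff_right
      by (simp add: inner_commute)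
    moreover have "?cost (Suc n) + 1/2 * (w (Suc n) \<bullet> ((mat 1 - lai_next A T (Suc n)) *v w (Suc n))) =
        1/2 * (u \<bullet> ((mat 1 - C) *v u))
        + 1/2 * ((w (Suc n) - C *v u) \<bullet> (D *v (w (Suc n) - C *v u)))"
      using cost_step[of A "lai_next A T (Suc n)" C "w (Suc n)" u] DC
      by (simp add: D_def lai_D_def hitting_cost_def w_def u_def)
    moreover have "?term (Suc n) = 1/2 * (d (Suc n) \<bullet> ((mat 1 - C) *v d (Suc n)))
        - ((mat 1 - C) *v w n) \<bullet> d (Suc n)
        + 1/2 * ((w (Suc n) - C *v u) \<bullet> (D *v (w (Suc n) - C *v u)))"
      by (simp add: C_def D_def d_def w_def u_def)
    moreover have "(\<Sum>t=1..n. ?cost t) + 1/2 * (w n \<bullet> ((mat 1 - C) *v w n)) = (\<Sum>t=1..n. ?term t)"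
      using Suc by (simp add: next_n)
    moreover have "sum ?cost {1..Suc n} = sum ?cost {1..n} + ?cost (Suc n)"
      "sum ?term {1..Suc n} = sum ?term {1..n} + ?term (Suc n)"
      by (rule sum.cl_ivl_Suc[THEN trans], simp)+
    ultimately show ?case by argo
  qed
  from this[of T] show ?thesis by (simp add: total_cost_def lai_next_def)
qed

text \<open>The pathwise decomposition is integrated term by term. Square integrability is asked of
  the deviations, which both LAI and any algorithm of finite expected cost satisfy.\<close>

lemma (in prob_space) has_bochner_integral_total_cost:
  fixes v x :: "nat \<Rightarrow> 'a \<Rightarrow> real ^ 'n"
  assumes A: "pos_def A"
    and v0: "v 0 = (\<lambda>_. x0)"
    and v: "\<And>t. t \<in> {1..T} \<Longrightarrow> v t \<in> borel_measurable M"
    and cov: "\<And>t. t \<in> {1..T} \<Longrightarrow> finite_covariance M (\<lambda>\<omega>. v t \<omega> - v (t - 1) \<omega>)"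
    and mart: "martingale_upto M T v"
    and x: "online_algorithm M T x0 v x"
    and sq: "\<And>t. t \<in> {1..T} \<Longrightarrow> square_integrable M (\<lambda>\<omega>. x t \<omega> - v t \<omega>)"
  shows "has_bochner_integral M (total_cost A T v x) (\<Sum>t=1..T.
      1/2 * (\<integral>\<omega>. (v t \<omega> - v (t - 1) \<omega>) \<bullet> ((mat 1 - lai_C A T t) *v (v t \<omega> - v (t - 1) \<omega>)) \<partial>M)
      + 1/2 * (\<integral>\<omega>. (x t \<omega> - v t \<omega> - lai_C A T t *v (x (t - 1) \<omega> - v t \<omega>)) \<bullet>
          (lai_D A T t *v (x t \<omega> - v t \<omega> - lai_C A T t *v (x (t - 1) \<omega> - v t \<omega>))) \<partial>M))"
proof -
  have x_init: "x 0 = (\<lambda>_. x0)"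
    and x_adapted: "\<And>t. t \<in> {1..T} \<Longrightarrow> x t \<in> borel_measurable (natural_filtration M v t)"
    using x by (auto simp: online_algorithm_def)
  have sq_d: "square_integrable M (\<lambda>\<omega>. v t \<omega> - v (t - 1) \<omega>)" if "t \<in> {1..T}" for t
    by (rule square_integrable_increment[OF v0 v cov that])
  have sq_w: "square_integrable M (\<lambda>\<omega>. x (t - 1) \<omega> - v (t - 1) \<omega>)" if "t \<in> {1..T}" for t
  proof (cases "t - 1 = 0")
    case False
    then have "t - 1 \<in> {1..T}" using that by auto
    then show ?thesis by (rule sq)
  qed (simp add: x_init v0 square_integrable_def)
  have "(\<integral>\<omega>. ((mat 1 - lai_C A T t) *v (x (t - 1) \<omega> - v (t - 1) \<omega>)) \<bullet> (v t \<omega> - v (t - 1) \<omega>) \<partial>M) = 0"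
    if t: "t \<in> {1..T}" for t
  \<comment> \<open>The first increment need not have mean zero; its cross term vanishes because x_0
    = v_0.\<close>
  proof (cases "t = 1")
    case True
    then show ?thesis by (simp add: x_init v0)
  next
    case False
    then obtain s where s: "t = Suc s" "1 \<le> s" "Suc s \<le> T" using t by (cases t) auto
    have [measurable]: "x s \<in> borel_measurable (natural_filtration M v s)"
      "v s \<in> borel_measurable (natural_filtration M v s)"
      using s by (auto intro: x_adapted measurable_natural_filtration)
    let ?Z = "\<lambda>\<omega>. (mat 1 - lai_C A T t) *v (x s \<omega> - v s \<omega>)"
    have "?Z \<in> borel_measurable (natural_filtration M v s)" by measurable
    moreover have "square_integrable M ?Z"
      using sq_w[OF t] s(1) by (intro square_integrable_matrix_vector) simp
    moreover have "square_integrable M (\<lambda>\<omega>. v (Suc s) \<omega> - v s \<omega>)"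
      using sq_d[OF t] s(1) by simp
    ultimately have "(\<integral>\<omega>. ?Z \<omega> \<bullet> (v (Suc s) \<omega> - v s \<omega>) \<partial>M) = 0"
      using v by (intro martingale_increment_orthogonal[OF mart s(2,3)]) simp_all
    then show ?thesis using s(1) by simp
  qed
  then have cross: "has_bochner_integral M (\<lambda>\<omega>.
      ((mat 1 - lai_C A T t) *v (x (t - 1) \<omega> - v (t - 1) \<omega>)) \<bullet> (v t \<omega> - v (t - 1) \<omega>)) 0"
    if "t \<in> {1..T}" for t
    using that square_integrable_inner[OF square_integrable_matrix_vector[OF sq_w] sq_d]
    by (simp add: has_bochner_integral_iff)
  have sq_delta: "square_integrable M (\<lambda>\<omega>. x t \<omega> - v t \<omega> - lai_C A T t *v (x (t - 1) \<omega> - v t \<omega>))"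
    if t: "t \<in> {1..T}" for t
  proof -
    \<comment> \<open>Rewrites x_(t-1) - v_t as the previous deviation minus the new
      increment.\<close>
    have "square_integrable M (\<lambda>\<omega>. (x (t - 1) \<omega> - v (t - 1) \<omega>) - (v t \<omega> - v (t - 1) \<omega>))"
      using sq_w[OF t] sq_d[OF t] by (rule square_integrable_diff)
    then have "square_integrable M (\<lambda>\<omega>. x (t - 1) \<omega> - v t \<omega>)" by simp
    from square_integrable_diff[OF sq[OF t] square_integrable_matrix_vector[OF this]]
    show ?thesis .
  qed
  have quad: "has_bochner_integral M (\<lambda>\<omega>. 1/2 * (X \<omega> \<bullet> (B *v X \<omega>))) (1/2 * (\<integral>\<omega>. X \<omega> \<bullet> (B *v X \<omega>) \<partial>M))"
    if "square_integrable M X" for X :: "'a \<Rightarrow> real ^ 'n" and B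
    using square_integrable_inner[OF that square_integrable_matrix_vector[OF that, of B]]
    by (intro has_bochner_integral_mult_right) (simp add: has_bochner_integral_integrable)
  have "has_bochner_integral M (\<lambda>\<omega>.
      1/2 * ((v t \<omega> - v (t - 1) \<omega>) \<bullet> ((mat 1 - lai_C A T t) *v (v t \<omega> - v (t - 1) \<omega>)))
      - ((mat 1 - lai_C A T t) *v (x (t - 1) \<omega> - v (t - 1) \<omega>)) \<bullet> (v t \<omega> - v (t - 1) \<omega>)
      + 1/2 * ((x t \<omega> - v t \<omega> - lai_C A T t *v (x (t - 1) \<omega> - v t \<omega>)) \<bullet>
          (lai_D A T t *v (x t \<omega> - v t \<omega> - lai_C A T t *v (x (t - 1) \<omega> - v t \<omega>)))))
     (1/2 * (\<integral>\<omega>. (v t \<omega> - v (t - 1) \<omega>) \<bullet> ((mat 1 - lai_C A T t) *v (v t \<omega> - v (t - 1) \<omega>)) \<partial>M) - 0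
      + 1/2 * (\<integral>\<omega>. (x t \<omega> - v t \<omega> - lai_C A T t *v (x (t - 1) \<omega> - v t \<omega>)) \<bullet>
          (lai_D A T t *v (x t \<omega> - v t \<omega> - lai_C A T t *v (x (t - 1) \<omega> - v t \<omega>))) \<partial>M))"
    if t: "t \<in> {1..T}" for t
    by (intro has_bochner_integral_add has_bochner_integral_diff cross[OF t] quad[OF sq_d[OF t]]
        quad[OF sq_delta[OF t]])
  from has_bochner_integral_sum[where I = "{1..T}", OF this]
  show ?thesis
    by (subst has_bochner_integral_cong[OF refl total_cost_decomposition[OF A] refl])
      (simp_all add: x_init v0)
qed

section \<open>Algorithms of finite expected cost, LAI, and the comparison\<close>

lemma total_cost_nonneg:
  assumes "pos_def A"
  shows "0 \<le> total_cost A T v x \<omega>"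
  unfolding total_cost_def hitting_cost_def
  using pos_def_nonneg[OF assms] by (intro sum_nonneg add_nonneg_nonneg) auto

text \<open>By coercivity of \<open>A\<close>, the squared deviation is at most 2/c times one
  hitting cost, itself part of a sum of nonnegative terms.\<close>

lemma square_integrable_deviation:
  fixes v x :: "nat \<Rightarrow> 'w \<Rightarrow> real ^ 'n"
  assumes A: "pos_def A"
    and v: "\<And>t. t \<in> {1..T} \<Longrightarrow> v t \<in> borel_measurable M"
    and x: "\<And>t. t \<in> {1..T} \<Longrightarrow> x t \<in> borel_measurable M"
    and int: "integrable M (total_cost A T v x)"
    and t: "t \<in> {1..T}"
  shows "square_integrable M (\<lambda>\<omega>. x t \<omega> - v t \<omega>)"
proof -
  obtain c where c: "c > 0" "\<And>y. c * (norm y)\<^sup>2 \<le> y \<bullet> (A *v y)"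
    using pos_def_coercive[OF A] by blast
  have [measurable]: "(\<lambda>\<omega>. x t \<omega> - v t \<omega>) \<in> borel_measurable M"
    using x[OF t] v[OF t] by measurable
  have bound: "(norm (x t \<omega> - v t \<omega>))\<^sup>2 \<le> 2 / c * total_cost A T v x \<omega>" for \<omega>
  proof -
    have "1/2 * (c * (norm (x t \<omega> - v t \<omega>))\<^sup>2) \<le> hitting_cost A (v t \<omega>) (x t \<omega>)"
      using c(2) by (simp add: hitting_cost_def)
    also have "\<dots> \<le> hitting_cost A (v t \<omega>) (x t \<omega>) + 1/2 * (norm (x t \<omega> - x (t - 1) \<omega>))\<^sup>2"
      by simp
    also have "\<dots> \<le> total_cost A T v x \<omega>"
      unfolding total_cost_def
      using t pos_def_nonneg[OF A]
      by (intro member_le_sum[of t "{1..T}"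
            "\<lambda>t. hitting_cost A (v t \<omega>) (x t \<omega>) + 1/2 * (norm (x t \<omega> - x (t - 1) \<omega>))\<^sup>2"])
        (auto simp: hitting_cost_def intro!: add_nonneg_nonneg)
    finally show ?thesis using c(1) by (simp add: field_simps)
  qed
  have bound: "norm ((norm (x t \<omega> - v t \<omega>))\<^sup>2) \<le> norm (2 / c * total_cost A T v x \<omega>)" for \<omega>
    using order_trans[OF bound[of \<omega>] abs_ge_self] by simp
  have "integrable M (\<lambda>\<omega>. (norm (x t \<omega> - v t \<omega>))\<^sup>2)"
    by (rule Bochner_Integration.integrable_bound
        [OF integrable_mult_right[OF int, of "2 / c"] _ AE_I2[OF bound]]) measurable
  then show ?thesis by (simp add: square_integrable_def)
qed

text \<open>LAI picks the minimizer w = C u of the completed square, so its error term is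
  zero.\<close>

lemma lai_deviation:
  "lai A T x0 v (Suc t) \<omega> - v (Suc t) \<omega> = lai_C A T (Suc t) *v (lai A T x0 v t \<omega> - v (Suc t) \<omega>)"
  by (simp add: matrix_vector_mult_diff_distrib matrix_vector_mult_diff_rdistrib)

lemma online_algorithm_lai:
  fixes v :: "nat \<Rightarrow> 'w \<Rightarrow> real ^ 'n"
  shows "online_algorithm M T x0 v (lai A T x0 v)"
proof -
  \<comment> \<open>Allowing any s <= t makes the earlier decision measurable for the later
    sigma-algebra directly from the induction hypothesis.\<close>
  have "lai A T x0 v s \<in> borel_measurable (natural_filtration M v t)" if "s \<le> t" for s t
    using that
  proof (induction s)
    case 0
    have "lai A T x0 v 0 = (\<lambda>_. x0)" by auto
    then show ?case by simp
  next
    case (Suc s)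
    then have [measurable]: "lai A T x0 v s \<in> borel_measurable (natural_filtration M v t)"
      "v (Suc s) \<in> borel_measurable (natural_filtration M v t)"
      by (auto intro: measurable_natural_filtration)
    have "lai A T x0 v (Suc s) = (\<lambda>\<omega>. lai_C A T (Suc s) *v lai A T x0 v s \<omega>
        + (mat 1 - lai_C A T (Suc s)) *v v (Suc s) \<omega>)" by auto
    then show ?case by simp
  qed
  then show ?thesis by (auto simp: online_algorithm_def)
qed

text \<open>Optimality compares extended nonnegative expectations, so competitors of infinite cost
  are included. The separate integrability claim ensures that the Bochner integral of the LAI cost
  is not its default value 0.\<close>

theorem theorem3p1:
  fixes M :: "'w measure"
    and A :: "real ^ 'n ^ 'n"
    and T :: nat
    and x0 :: "real ^ 'n"
    and v :: "nat \<Rightarrow> 'w \<Rightarrow> real ^ 'n"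
  assumes "prob_space M"
    and "pos_def A"
    and "T \<ge> 1"
    and "v 0 = (\<lambda>_. x0)"
    and "\<And>t. t \<in> {1..T} \<Longrightarrow> v t \<in> borel_measurable M"
    and "\<And>t. t \<in> {1..T} \<Longrightarrow> finite_covariance M (\<lambda>\<omega>. v t \<omega> - v (t - 1) \<omega>)"
    and "martingale_upto M T v"
  shows "online_optimal M A T x0 v (lai A T x0 v) \<and>
    integrable M (total_cost A T v (lai A T x0 v)) \<and>
    (\<integral>\<omega>. total_cost A T v (lai A T x0 v) \<omega> \<partial>M)
      = (\<Sum>t=1..T. 1/2 * (\<integral>\<omega>. (v t \<omega> - v (t - 1) \<omega>) \<bullet> ((mat 1 - lai_C A T t) *v (v t \<omega> - v (t - 1) \<omega>)) \<partial>M)) \<and>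
    (\<Sum>t=1..T. 1/2 * (\<integral>\<omega>. (v t \<omega> - v (t - 1) \<omega>) \<bullet> ((mat 1 - lai_C A T t) *v (v t \<omega> - v (t - 1) \<omega>)) \<partial>M))
      \<le> (\<Sum>t=1..T. 1/2 * (\<integral>\<omega>. (v t \<omega> - v (t - 1) \<omega>) \<bullet> ((mat 1 - C_L A) *v (v t \<omega> - v (t - 1) \<omega>)) \<partial>M))"
proof -
  interpret prob_space M by fact
  note A = assms(2) and v0 = assms(4) and v = assms(5) and cov = assms(6) and mart = assms(7)
  note cost_integral = has_bochner_integral_total_cost[OF A v0 v cov mart]
  let ?lai = "lai A T x0 v"
  let ?cost = "\<Sum>t=1..T. 1/2 * (\<integral>\<omega>. (v t \<omega> - v (t - 1) \<omega>) \<bullet>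
    ((mat 1 - lai_C A T t) *v (v t \<omega> - v (t - 1) \<omega>)) \<partial>M)"
  have sq_d: "square_integrable M (\<lambda>\<omega>. v t \<omega> - v (t - 1) \<omega>)" if "t \<in> {1..T}" for t
    by (rule square_integrable_increment[OF v0 v cov that])
  \<comment> \<open>Each LAI deviation is a matrix applied to the previous one minus an increment,
    so L^2 membership propagates from w_0 = 0.\<close>
  have "square_integrable M (\<lambda>\<omega>. ?lai t \<omega> - v t \<omega>)" if "t \<le> T" for t
    using that
  proof (induction t)
    case 0
    then show ?case by (simp add: v0 square_integrable_def)
  next
    case (Suc t)
    have "square_integrable M (\<lambda>\<omega>. (?lai t \<omega> - v t \<omega>) - (v (Suc t) \<omega> - v t \<omega>))"
      using Suc sq_d[of "Suc t"] by (intro square_integrable_diff[of M "\<lambda>\<omega>. ?lai t \<omega> - v t \<omega>"]) auto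
    then show ?case
      unfolding lai_deviation by (intro square_integrable_matrix_vector) simp
  qed
  then have "has_bochner_integral M (total_cost A T v ?lai) (\<Sum>t=1..T.
      1/2 * (\<integral>\<omega>. (v t \<omega> - v (t - 1) \<omega>) \<bullet> ((mat 1 - lai_C A T t) *v (v t \<omega> - v (t - 1) \<omega>)) \<partial>M)
      + 1/2 * (\<integral>\<omega>. (?lai t \<omega> - v t \<omega> - lai_C A T t *v (?lai (t - 1) \<omega> - v t \<omega>)) \<bullet>
          (lai_D A T t *v (?lai t \<omega> - v t \<omega> - lai_C A T t *v (?lai (t - 1) \<omega> - v t \<omega>))) \<partial>M))"
    by (intro cost_integral online_algorithm_lai) auto
  also have "(\<Sum>t=1..T.
      1/2 * (\<integral>\<omega>. (v t \<omega> - v (t - 1) \<omega>) \<bullet> ((mat 1 - lai_C A T t) *v (v t \<omega> - v (t - 1) \<omega>)) \<partial>M)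
      + 1/2 * (\<integral>\<omega>. (?lai t \<omega> - v t \<omega> - lai_C A T t *v (?lai (t - 1) \<omega> - v t \<omega>)) \<bullet>
          (lai_D A T t *v (?lai t \<omega> - v t \<omega> - lai_C A T t *v (?lai (t - 1) \<omega> - v t \<omega>))) \<partial>M)) = ?cost"
  proof (rule sum.cong)
    fix t assume "t \<in> {1..T}"
    then obtain s where "t = Suc s" by (cases t) auto
    then have "?lai t \<omega> - v t \<omega> - lai_C A T t *v (?lai (t - 1) \<omega> - v t \<omega>) = 0" for \<omega>
      by (simp only: lai_deviation) simp
    then show "1/2 * (\<integral>\<omega>. (v t \<omega> - v (t - 1) \<omega>) \<bullet> ((mat 1 - lai_C A T t) *v (v t \<omega> - v (t - 1) \<omega>)) \<partial>M)
      + 1/2 * (\<integral>\<omega>. (?lai t \<omega> - v t \<omega> - lai_C A T t *v (?lai (t - 1) \<omega> - v t \<omega>)) \<bullet>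
          (lai_D A T t *v (?lai t \<omega> - v t \<omega> - lai_C A T t *v (?lai (t - 1) \<omega> - v t \<omega>))) \<partial>M)
      = 1/2 * (\<integral>\<omega>. (v t \<omega> - v (t - 1) \<omega>) \<bullet> ((mat 1 - lai_C A T t) *v (v t \<omega> - v (t - 1) \<omega>)) \<partial>M)"
      by (simp only: matrix_vector_mult_0_right inner_zero_right) simp
  qed simp
  finally have lai: "has_bochner_integral M (total_cost A T v ?lai) ?cost" .
  have lai_cost: "expected_cost M A T v ?lai = ennreal ?cost"
    unfolding expected_cost_def
    using lai by (subst nn_integral_eq_integral)
      (simp_all add: has_bochner_integral_iff total_cost_nonneg[OF A])
  have "expected_cost M A T v ?lai \<le> expected_cost M A T v y" if y: "online_algorithm M T x0 v y" for y
  proof (cases "expected_cost M A T v y = \<infinity>")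
    \<comment> \<open>Only finite cost needs an argument; there the deviations of \<open>y\<close>
      are square integrable and the decomposition can be integrated.\<close>
    case False
    have y0: "y 0 = (\<lambda>_. x0)" using y by (simp add: online_algorithm_def)
    have y_meas: "y t \<in> borel_measurable M" if t: "t \<in> {1..T}" for t
    proof (rule measurable_from_subalg)
      show "subalgebra M (natural_filtration M v t)"
        using t v by (intro subalgebra_natural_filtration) auto
      show "y t \<in> borel_measurable (natural_filtration M v t)"
        using y t by (simp add: online_algorithm_def)
    qed
    have y_meas': "y (t - 1) \<in> borel_measurable M" if "t \<in> {1..T}" for t
    proof (cases "t - 1 = 0")
      case False
      then have "t - 1 \<in> {1..T}" using that by auto
      then show ?thesis by (rule y_meas)
    qed (simp add: y0)
    have "(\<lambda>\<omega>. total_cost A T v y \<omega>) \<in> borel_measurable M"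
      unfolding total_cost_def hitting_cost_def
      by (intro borel_measurable_sum borel_measurable_add borel_measurable_times
          borel_measurable_const borel_measurable_inner borel_measurable_matrix_vector
          borel_measurable_diff borel_measurable_power
          measurable_compose[OF _ borel_measurable_norm] v y_meas y_meas')
    then have int: "integrable M (total_cost A T v y)"
      using False by (intro integrableI_nonneg)
        (simp_all add: expected_cost_def less_top total_cost_nonneg[OF A])
    have "has_bochner_integral M (total_cost A T v y) (\<Sum>t=1..T.
      1/2 * (\<integral>\<omega>. (v t \<omega> - v (t - 1) \<omega>) \<bullet> ((mat 1 - lai_C A T t) *v (v t \<omega> - v (t - 1) \<omega>)) \<partial>M)
      + 1/2 * (\<integral>\<omega>. (y t \<omega> - v t \<omega> - lai_C A T t *v (y (t - 1) \<omega> - v t \<omega>)) \<bullet>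
          (lai_D A T t *v (y t \<omega> - v t \<omega> - lai_C A T t *v (y (t - 1) \<omega> - v t \<omega>))) \<partial>M))"
      using square_integrable_deviation[OF A v y_meas int] by (intro cost_integral y) auto
    then have "(\<integral>\<omega>. total_cost A T v y \<omega> \<partial>M) = (\<Sum>t=1..T.
      1/2 * (\<integral>\<omega>. (v t \<omega> - v (t - 1) \<omega>) \<bullet> ((mat 1 - lai_C A T t) *v (v t \<omega> - v (t - 1) \<omega>)) \<partial>M)
      + 1/2 * (\<integral>\<omega>. (y t \<omega> - v t \<omega> - lai_C A T t *v (y (t - 1) \<omega> - v t \<omega>)) \<bullet>
          (lai_D A T t *v (y t \<omega> - v t \<omega> - lai_C A T t *v (y (t - 1) \<omega> - v t \<omega>))) \<partial>M))"
      by (rule has_bochner_integral_integral_eq)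
    \<comment> \<open>Drops the error terms, nonnegative since each \<open>lai_D A T t\<close> is
      positive definite.\<close>
    also have "\<dots> \<ge> ?cost"
      using pos_def_nonneg[OF pos_def_lai_D[OF A]]
      by (intro sum_mono) (simp add: Bochner_Integration.integral_nonneg)
    finally have "?cost \<le> (\<integral>\<omega>. total_cost A T v y \<omega> \<partial>M)" .
    moreover have "expected_cost M A T v y = ennreal (\<integral>\<omega>. total_cost A T v y \<omega> \<partial>M)"
      unfolding expected_cost_def
      using int by (intro nn_integral_eq_integral) (simp_all add: total_cost_nonneg[OF A])
    ultimately show ?thesis by (simp add: lai_cost ennreal_leI)
  qed simp
  then have "online_optimal M A T x0 v ?lai"
    by (simp add: online_optimal_def online_algorithm_lai)
  moreover have "?cost \<le> (\<Sum>t=1..T. 1/2 * (\<integral>\<omega>. (v t \<omega> - v (t - 1) \<omega>) \<bullet>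
      ((mat 1 - C_L A) *v (v t \<omega> - v (t - 1) \<omega>)) \<partial>M))"
  proof (intro sum_mono mult_left_mono integral_mono)
    fix t assume t: "t \<in> {1..T}"
    show "integrable M (\<lambda>\<omega>. (v t \<omega> - v (t - 1) \<omega>) \<bullet> ((mat 1 - lai_C A T t) *v (v t \<omega> - v (t - 1) \<omega>)))"
      "integrable M (\<lambda>\<omega>. (v t \<omega> - v (t - 1) \<omega>) \<bullet> ((mat 1 - C_L A) *v (v t \<omega> - v (t - 1) \<omega>)))"
      by (intro square_integrable_inner square_integrable_matrix_vector sq_d t)+
    \<comment> \<open>Subtraction from the identity reverses C_L <= C_t.\<close>
    show "(v t \<omega> - v (t - 1) \<omega>) \<bullet> ((mat 1 - lai_C A T t) *v (v t \<omega> - v (t - 1) \<omega>)) \<le>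
        (v t \<omega> - v (t - 1) \<omega>) \<bullet> ((mat 1 - C_L A) *v (v t \<omega> - v (t - 1) \<omega>))" for \<omega>
      unfolding matrix_vector_mult_diff_rdistrib inner_diff_right lai_C_def
      using C_L_le_lai_back[OF A] by simp
  qed simp
  ultimately show ?thesis using lai by (simp add: has_bochner_integral_iff)
qed

end
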